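(* Let $p>3$ be a prime and let $j$ be a positive integer with $j\mid p-1$ and $\mathrm{ord}_p(-2)=\frac{p-1}{j}$. Then the permutations of $\mathbb{F}_p$ induced by $D_2(1,x)$ and by $D_{2p}(1,x)$ both have cycle type $\bigl(\underbrace{\tfrac{p-1}{j},\dots,\tfrac{p-1}{j}}_{j\text{ times}},1\bigr)$. In particular, if $-2$ is a primitive root modulo $p$ (i.e. $j=1$), then the cycle type of both permutations is $(p-1,1)$.
   Context: The $n$th reversed Dickson polynomial of the first kind (with parameter $1$) is the integer-coefficient polynomial $D_n(1,x)$ defined by $D_0(1,x)=2$, $D_1(1,x)=1$, $D_n(1,x)=D_{n-1}(1,x)-x\,D_{n-2}(1,x)$ for $n\ge 2$. Coefficients are reduced modulo $p$ to regard it as a polynomial over $\mathbb{F}_p$. For an integer $a$ prime to $p$, $\mathrm{ord}_p(a)$ is the multiplicative order of $a$ modulo $p$. The cycle type of a permutation of $\mathbb{F}_p$ is the multiset of lengths of the cycles in its disjoint cycle decomposition, fixed points being counted as cycles of length $1$. *)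

theory Defs
  imports
    "Berlekamp_Zassenhaus.Finite_Field"
    "HOL-Number_Theory.Residue_Primitive_Roots"
    "HOL-Combinatorics.Orbits"
begin

text \<open>The reversed Dickson polynomials of the first kind \<open>D\<^sub>n(1,x)\<close>.\<close>

fun rev_dickson :: "nat \<Rightarrow> int poly" where
  "rev_dickson 0 = [:2:]"
| "rev_dickson (Suc 0) = [:1:]"
| "rev_dickson (Suc (Suc n)) = rev_dickson (Suc n) - [:0, 1:] * rev_dickson n"

text \<open>
  The field with \<open>p\<close> elements is the type \<open>'p mod_ring\<close>, where \<open>'p\<close> is an index
  type with \<open>CARD('p) = p\<close>.  The polynomial is first reduced coefficientwise and then evaluated.
\<close>

definition rev_dickson_map :: "nat \<Rightarrow> 'p::prime_card mod_ring \<Rightarrow> 'p mod_ring" where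
  "rev_dickson_map n = poly (map_poly of_int (rev_dickson n))"

text \<open>
  The orbits of a permutation of a finite type are the supports of the cycles in its disjoint
  cycle decomposition, and the length of a cycle is the size of its support; a fixed point
  \<open>x\<close> contributes the orbit \<open>{x}\<close>, hence the length 1.  The set of orbits, not the family indexed
  by the points, is what is turned into a multiset, so each cycle counts once.
\<close>

definition cycle_type :: "('a::finite \<Rightarrow> 'a) \<Rightarrow> nat multiset" where
  "cycle_type f = image_mset card (mset_set (range (orbit f)))"

text \<open>The library's \<open>ord p\<close> takes natural numbers, so an integer enters as its residue.\<close>

definition ord_int :: "nat \<Rightarrow> int \<Rightarrow> nat" where
  "ord_int p a = ord p (nat (a mod int p))"

definition primroot_int :: "nat \<Rightarrow> int \<Rightarrow> bool" where
  "primroot_int p a \<longleftrightarrow> residue_primroot p (nat (a mod int p))"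

end

theory Submission
  imports Defs "Berlekamp_Zassenhaus.Berlekamp_Type_Based"
begin

text \<open>
  Both polynomials induce the affine map \<open>x \<mapsto> 1 - 2 x\<close> on \<open>F\<^sub>p\<close>. For \<open>D\<^sub>2(1,x) = 1 - 2 x\<close>
  this is the definition. For \<open>D\<^sub>2\<^sub>p\<close> the reason is the functional equation
  \<open>D\<^sub>n(1, Y(1 - Y)) = Y\<^sup>n + (1 - Y)\<^sup>n\<close>: in characteristic \<open>p\<close> raising to the \<open>p\<close>-th power is
  additive, so passing from \<open>n\<close> to \<open>n p\<close> raises the right-hand side to the \<open>p\<close>-th power, and
  because substituting the non-constant \<open>Y(1 - Y)\<close> is injective on polynomials, \<open>D\<^sub>n\<^sub>p = D\<^sub>n\<^sup>p\<close>
  modulo \<open>p\<close> (\<open>rev_dickson_mod_mult_card\<close>). On \<open>F\<^sub>p\<close> the \<open>p\<close>-th power is the identity, so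
  \<open>D\<^sub>n\<^sub>p\<close> and \<open>D\<^sub>n\<close> induce the same map. Working with polynomials in \<open>Y\<close> replaces solving
  \<open>x = y(1 - y)\<close>, whose solutions in general lie only in the quadratic extension of \<open>F\<^sub>p\<close>.

  An affine map \<open>x \<mapsto> a x + b\<close> with \<open>a \<notin> {0, 1}\<close> has exactly one fixed point \<open>c\<close>, and in the coordinate
  \<open>x - c\<close> it is multiplication by \<open>a\<close>. Away from \<open>c\<close> its cycles are therefore translated cosets
  of the group generated by \<open>a\<close>, all of length \<open>d\<close>, the multiplicative order of \<open>a\<close>; they
  partition the other points (\<open>cycle_type_affine\<close>). Here \<open>a = -2\<close>, and \<open>p \<noteq> 3\<close> means \<open>-2 \<noteq> 1\<close>.
\<close>

lemma affine_permutes_UNIV: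
  fixes a b :: "'a :: finite_field"
  assumes "a \<noteq> 0"
  shows "(\<lambda>x. a * x + b) permutes UNIV"
proof -
  have "inj (\<lambda>x. a * x + b)"
    using assms by (auto intro: injI)
  then show ?thesis
    by (intro bij_imp_permutes) (auto simp: bij_def finite_UNIV_inj_surj)
qed

text \<open>
  Moving the origin to the fixed point \<open>c\<close> turns the affine map into multiplication by \<open>a\<close>.
\<close>

lemma funpow_affine:
  fixes a b c x :: "'a :: comm_ring_1"
  assumes "a * c + b = c"
  shows "((\<lambda>x. a * x + b) ^^ n) x = c + a ^ n * (x - c)"
proof (induction n)
  case (Suc n)
  have "a * (c + a ^ n * (x - c)) + b = (a * c + b) + a ^ Suc n * (x - c)"
    by (simp add: algebra_simps)
  with Suc assms show ?case by simp
qed simp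

lemma inj_on_power_of_order:
  fixes a :: "'a :: idom"
  assumes "a \<noteq> 0" and order: "\<And>n. a ^ n = 1 \<longleftrightarrow> d dvd n"
  shows "inj_on (\<lambda>n. a ^ n) {..<d}"
proof (rule linorder_inj_onI)
  fix m k :: nat
  assume "m < k" "m \<in> {..<d}" "k \<in> {..<d}"
  have "\<not> d dvd k - m"
    using \<open>m < k\<close> \<open>k \<in> {..<d}\<close> by (auto dest: dvd_imp_le)
  then have "a ^ (k - m) \<noteq> 1"
    by (simp add: order)
  moreover have "a ^ k = a ^ m * a ^ (k - m)"
    using \<open>m < k\<close> by (simp flip: power_add)
  ultimately show "a ^ m \<noteq> a ^ k"
    using \<open>a \<noteq> 0\<close> by simp
qed auto

text \<open>
  The orbit of \<open>x\<close> is the image of the \<open>d\<close> distinct powers of \<open>a\<close> under the map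
  \<open>y \<mapsto> c + y (x - c)\<close>, which is injective because \<open>x \<noteq> c\<close>.
\<close>

lemma card_orbit_affine:
  fixes a b c x :: "'a :: idom"
  assumes fixed: "a * c + b = c" and "x \<noteq> c" and "d > 0"
    and order: "\<And>n. a ^ n = 1 \<longleftrightarrow> d dvd n"
  shows "card (orbit (\<lambda>x. a * x + b) x) = d"
proof -
  have "a ^ d = 1" by (simp add: order)
  then have "a \<noteq> 0" using \<open>d > 0\<close> by (auto simp: power_0_left)
  have "orbit (\<lambda>x. a * x + b) x = {((\<lambda>x. a * x + b) ^^ m) x | m. m < d}"
    using \<open>d > 0\<close> \<open>a ^ d = 1\<close>
    by (intro orbit_altdef_bounded) (simp_all add: funpow_affine[OF fixed])
  also have "\<dots> = (\<lambda>y. c + y * (x - c)) ` (\<lambda>m. a ^ m) ` {..<d}"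
    by (auto simp: funpow_affine[OF fixed])
  finally have "card (orbit (\<lambda>x. a * x + b) x)
      = card ((\<lambda>y. c + y * (x - c)) ` (\<lambda>m. a ^ m) ` {..<d})"
    by simp
  also have "\<dots> = card ((\<lambda>m. a ^ m) ` {..<d})"
    using \<open>x \<noteq> c\<close> by (intro card_image inj_onI) auto
  also have "\<dots> = d"
    by (simp add: card_image inj_on_power_of_order[OF \<open>a \<noteq> 0\<close> order])
  finally show ?thesis .
qed

lemma orbit_eq_or_disjoint:
  assumes "permutation f"
  shows "orbit f x = orbit f y \<or> orbit f x \<inter> orbit f y = {}"
  using cyclic_on_orbit'[OF assms] orbit_cyclic_eq3 by (metis disjoint_iff)

text \<open>
  The number of long cycles is not computed directly: they are disjoint, have the same size \<open>d\<close>
  and cover everything except the fixed point, so counting points gives it.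
\<close>

theorem cycle_type_affine:
  fixes a b :: "'a :: finite_field"
  assumes "a \<noteq> 1" and "d > 0" and order: "\<And>n. a ^ n = 1 \<longleftrightarrow> d dvd n"
  shows "cycle_type (\<lambda>x. a * x + b) = replicate_mset ((CARD('a) - 1) div d) d + {#1#}"
proof -
  define f where "f = (\<lambda>x. a * x + b)"
  define c where "c = b / (1 - a)"
  have fixed: "a * c + b = c"
    using \<open>a \<noteq> 1\<close> by (simp add: c_def field_simps)
  have "a ^ d = 1" by (simp add: order)
  then have "a \<noteq> 0" using \<open>d > 0\<close> by (auto simp: power_0_left)
  then have perm: "permutation f"
    using affine_permutes_UNIV[of a b] by (auto simp: f_def permutation_permutes)
  have orbit_c: "orbit f c = {c}"
    using fixed by (simp add: orbit_eq_singleton_iff f_def)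
  define P where "P = orbit f ` (UNIV - {c})"
  have card_P: "card A = d" if "A \<in> P" for A
    using that card_orbit_affine[OF fixed _ \<open>d > 0\<close> order] by (auto simp: P_def f_def)
  have self: "x \<in> orbit f x" for x
    by (rule permutation_self_in_orbit[OF perm])
  have c_notin: "c \<notin> orbit f x" if "x \<noteq> c" for x
    using orbit_eq_or_disjoint[OF perm, of x c] orbit_c self[of x] that by auto
  have "\<Union>P = UNIV - {c}"
    using self c_notin by (auto simp: P_def)
  moreover have "d * card P = card (\<Union>P)"
  proof (rule card_partition)
    show "A \<inter> B = {}" if "A \<in> P" "B \<in> P" "A \<noteq> B" for A B
      using that orbit_eq_or_disjoint[OF perm] by (auto simp: P_def)
  qed (auto simp: card_P)
  ultimately have "d * card P = CARD('a) - 1"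
    by (simp add: card_Diff_singleton)
  then have number: "card P = (CARD('a) - 1) div d"
    using \<open>d > 0\<close> by (metis nonzero_mult_div_cancel_left not_gr_zero)
  have "range (orbit f) = insert {c} P"
    using orbit_c by (auto simp: P_def)
  moreover have "{c} \<notin> P"
    using c_notin by (auto simp: P_def)
  ultimately have "cycle_type f = image_mset card (mset_set P) + {#1#}"
    by (simp add: cycle_type_def)
  also have "image_mset card (mset_set P) = image_mset (\<lambda>_. d) (mset_set P)"
    by (intro image_mset_cong) (simp add: card_P)
  also have "\<dots> = replicate_mset ((CARD('a) - 1) div d) d"
    by (simp add: image_mset_const_eq number)
  finally show ?thesis by (simp add: f_def)
qed

abbreviation rev_dickson_mod :: "nat \<Rightarrow> 'p :: prime_card mod_ring poly" where
  "rev_dickson_mod n \<equiv> map_poly of_int (rev_dickson n)"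

lemma rev_dickson_mod_rec:
  "rev_dickson_mod (Suc (Suc n)) = rev_dickson_mod (Suc n) - [:0, 1:] * rev_dickson_mod n"
  by (simp add: of_int_poly_hom.hom_minus of_int_poly_hom.hom_mult del: mult_pCons_left)

text \<open>
  The elements \<open>Y\<close> and \<open>1 - Y\<close> are the roots of \<open>t\<^sup>2 - t + Y(1 - Y)\<close>, the characteristic polynomial
  of the recurrence at \<open>x = Y(1 - Y)\<close>; the initial values \<open>2\<close> and \<open>1\<close> make the solution the sum
  of their \<open>n\<close>-th powers.
\<close>

lemma rev_dickson_mod_pcompose:
  "(rev_dickson_mod n :: 'p :: prime_card mod_ring poly) \<circ>\<^sub>p ([:0, 1:] * [:1, -1:])
     = [:0, 1:] ^ n + [:1, -1:] ^ n"
proof (induction n rule: rev_dickson.induct)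
  case (3 n)
  define Y Z :: "'p mod_ring poly" where "Y = [:0, 1:]" and "Z = [:1, -1:]"
  have "Y + Z = 1" by (simp add: Y_def Z_def one_pCons del: pCons_one)
  have X: "[:0, 1:] \<circ>\<^sub>p (Y * Z) = Y * Z"
    by (simp add: pcompose_pCons)
  have "rev_dickson_mod (Suc (Suc n)) \<circ>\<^sub>p (Y * Z)
      = (Y ^ Suc n + Z ^ Suc n) - (Y * Z) * (Y ^ n + Z ^ n)"
    using 3 unfolding rev_dickson_mod_rec
    by (simp only: pcompose_diff pcompose_mult X[folded Y_def] flip: Y_def Z_def)
  \<comment> \<open>Multiplying by \<open>Y + Z = 1\<close> makes the mixed terms \<open>Z Y\<^sup>n\<^sup>+\<^sup>1\<close> and \<open>Y Z\<^sup>n\<^sup>+\<^sup>1\<close> cancel.\<close>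
  also have "\<dots> = (Y + Z) * (Y ^ Suc n + Z ^ Suc n) - (Y * Z) * (Y ^ n + Z ^ n)"
    by (simp add: \<open>Y + Z = 1\<close>)
  also have "\<dots> = Y ^ Suc (Suc n) + Z ^ Suc (Suc n)"
    by (simp add: algebra_simps)
  finally show ?case by (simp only: Y_def Z_def)
qed (simp_all add: pcompose_pCons one_pCons del: pCons_one)

lemma pcompose_cancel:
  fixes p q r :: "'a :: idom poly"
  assumes "degree r > 0" and "p \<circ>\<^sub>p r = q \<circ>\<^sub>p r"
  shows "p = q"
  using pcompose_eq_0[of "p - q" r] assms by (simp add: pcompose_diff)

text \<open>
  After substituting \<open>Y(1 - Y)\<close> this is \<open>Y\<^sup>n\<^sup>p + (1 - Y)\<^sup>n\<^sup>p = (Y\<^sup>n + (1 - Y)\<^sup>n)\<^sup>p\<close>, the additivity of the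
  Frobenius map on polynomials over \<open>F\<^sub>p\<close>.
\<close>

lemma rev_dickson_mod_mult_card:
  "(rev_dickson_mod (n * CARD('p)) :: 'p :: prime_card mod_ring poly)
     = rev_dickson_mod n ^ CARD('p)"
proof (rule pcompose_cancel)
  let ?q = "[:0, 1:] * [:1, -1:] :: 'p mod_ring poly"
  have "?q = [:0, 1, -1:]"
    by (simp add: one_pCons del: pCons_one)
  then show "degree ?q > 0" by (simp del: mult_pCons_left mult_pCons_right)
  show "rev_dickson_mod (n * CARD('p)) \<circ>\<^sub>p ?q = (rev_dickson_mod n ^ CARD('p)) \<circ>\<^sub>p ?q"
    by (simp only: pcompose_hom.hom_power rev_dickson_mod_pcompose add_power_poly_mod_ring
        power_mult)
qed

lemma rev_dickson_map_mult_card: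
  "(rev_dickson_map (n * CARD('p)) :: 'p :: prime_card mod_ring \<Rightarrow> 'p mod_ring)
     = rev_dickson_map n"
  using finite_field_power_card_eq_same[where 'a = "'p mod_ring"]
  by (simp add: rev_dickson_map_def rev_dickson_mod_mult_card fun_eq_iff)

lemma rev_dickson_map_2: "rev_dickson_map 2 = (\<lambda>x. - 2 * x + 1)"
proof -
  have "rev_dickson 2 = [:1, -2:]"
    by (simp add: numeral_2_eq_2 one_pCons del: pCons_one)
  then show ?thesis
    by (simp add: rev_dickson_map_def fun_eq_iff)
qed

text \<open>
  Equality in \<open>F\<^sub>p\<close> is congruence modulo \<open>p\<close>. This carries the number-theoretic order over to the
  field, in the form in which \<open>cycle_type_affine\<close> takes it.
\<close>

lemma of_int_power_eq_1_iff_ord_int_dvd: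
  "(of_int a :: 'p :: prime_card mod_ring) ^ n = 1 \<longleftrightarrow> ord_int CARD('p) a dvd n"
proof -
  let ?r = "nat (a mod int CARD('p))"
  have "(of_int a :: 'p mod_ring) = of_int (a mod int CARD('p))"
    using of_int_mod_CHAR[of a, where 'a = "'p mod_ring"] by simp
  also have "\<dots> = of_nat ?r"
    by simp
  finally have "(of_int a :: 'p mod_ring) ^ n = 1 \<longleftrightarrow> (of_nat (?r ^ n) :: 'p mod_ring) = of_nat 1"
    by simp
  also have "\<dots> \<longleftrightarrow> [?r ^ n = 1] (mod CARD('p))"
    by (subst of_nat_eq_iff_cong_CHAR) simp
  also have "\<dots> \<longleftrightarrow> ord_int CARD('p) a dvd n"
    by (simp only: ord_divides ord_int_def)
  finally show ?thesis .
qed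

theorem theorem3p9:
  fixes p :: nat
  assumes "prime p" and "p > 3" and "CARD('p::prime_card) = p"
  shows
    "(\<forall>j::nat. j > 0 \<longrightarrow> j dvd p - 1 \<longrightarrow> ord_int p (-2) = (p - 1) div j \<longrightarrow>
       (\<forall>n\<in>{2, 2 * p}.
          (rev_dickson_map n :: 'p mod_ring \<Rightarrow> 'p mod_ring) permutes UNIV \<and>
          cycle_type (rev_dickson_map n :: 'p mod_ring \<Rightarrow> 'p mod_ring)
            = replicate_mset j ((p - 1) div j) + {#1#}))
     \<and> (primroot_int p (-2) \<longrightarrow>
       (\<forall>n\<in>{2, 2 * p}.
          (rev_dickson_map n :: 'p mod_ring \<Rightarrow> 'p mod_ring) permutes UNIV \<and>
          cycle_type (rev_dickson_map n :: 'p mod_ring \<Rightarrow> 'p mod_ring) = {#p - 1, 1#}))"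
proof -
  have map_eq: "(rev_dickson_map n :: 'p mod_ring \<Rightarrow> 'p mod_ring) = (\<lambda>x. - 2 * x + 1)"
    if "n \<in> {2, 2 * p}" for n
    using that rev_dickson_map_mult_card[of 2, where 'p = 'p] rev_dickson_map_2 assms(3) by auto
  have small: "(of_nat k :: 'p mod_ring) \<noteq> 0" if "0 < k" "k \<le> 3" for k
    using of_nat_0_mod_ring_dvd[of k, where 'a = 'p] dvd_imp_le[of p k] that assms(2,3) by auto
  have "(-2 :: 'p mod_ring) \<noteq> 0"
    using small[of 2] by simp
  have "(-2 :: 'p mod_ring) \<noteq> 1"
  proof
    assume "(-2 :: 'p mod_ring) = 1"
    moreover have "(of_nat 3 :: 'p mod_ring) = 1 - (-2)" by simp
    ultimately show False using small[of 3] by simp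
  qed
  have order: "(-2 :: 'p mod_ring) ^ n = 1 \<longleftrightarrow> ord_int p (-2) dvd n" for n
    using of_int_power_eq_1_iff_ord_int_dvd[of "-2" n, where 'p = 'p] assms(3) by simp
  have perm: "(rev_dickson_map n :: 'p mod_ring \<Rightarrow> 'p mod_ring) permutes UNIV"
    if "n \<in> {2, 2 * p}" for n
    using affine_permutes_UNIV[OF \<open>-2 \<noteq> 0\<close>, of 1] map_eq[OF that] by simp
  have type: "cycle_type (rev_dickson_map n :: 'p mod_ring \<Rightarrow> 'p mod_ring)
      = replicate_mset j ((p - 1) div j) + {#1#}"
    if "j > 0" "j dvd p - 1" "ord_int p (-2) = (p - 1) div j" "n \<in> {2, 2 * p}" for j n
  proof -
    obtain d where d: "p - 1 = j * d" using \<open>j dvd p - 1\<close> by auto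
    then have "d > 0" using \<open>p > 3\<close> by (cases "d = 0") auto
    have "ord_int p (-2) = d" using that d by simp
    with order have "(-2 :: 'p mod_ring) ^ n = 1 \<longleftrightarrow> d dvd n" for n by simp
    from cycle_type_affine[OF \<open>-2 \<noteq> 1\<close> \<open>d > 0\<close> this, of 1]
    show ?thesis
      using map_eq[OF that(4)] d \<open>d > 0\<close> \<open>j > 0\<close> assms(3) by simp
  qed
  show ?thesis
  proof (intro conjI allI impI ballI perm)
    fix n assume "primroot_int p (-2)" and n: "n \<in> {2, 2 * p}"
    then have "ord_int p (-2) = (p - 1) div 1"
      using \<open>prime p\<close>
      by (simp add: primroot_int_def residue_primroot_def ord_int_def totient_prime)
    from type[OF _ _ this n] show
      "cycle_type (rev_dickson_map n :: 'p mod_ring \<Rightarrow> 'p mod_ring) = {#p - 1, 1#}"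
      by simp
  qed (use type in auto)
qed

end
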